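(* Let $T\ge1$ and $c_i\in\mathbb Z_+$, and define $F_i:[0,1]^T\to\mathbb R_+$ by $$F_i(u_1,\dots,u_T)=\mathbb E\Big\{\min\Big\{c_i,\sum_{t=1}^T B_{it}(u_t)\Big\}\Big\},$$ where $B_{i1}(u_1),\dots,B_{iT}(u_T)$ are independent Bernoulli random variables with parameters $u_1,\dots,u_T$. Then $F_i$ is differentiable and continuous DR-submodular. Furthermore, $F_i(u_1,\dots,u_T)$ is linear (i.e. affine) in each $u_t$, $t=1,\dots,T$, when the other coordinates are held fixed.
   Context: Here $c_i$ is the initial inventory of product $i$. For a box $\mathcal X\subseteq\mathbb R_+^d$, a differentiable function $G:\mathcal X\to\mathbb R_+$ is called continuous DR-submodular if $\nabla G(x)\le\nabla G(y)$ (component-wise) for all $x,y\in\mathcal X$ with $x\ge y$ (component-wise). *)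

theory Defs
  imports "HOL-Probability.Probability"
begin

definition bernoulli_rv :: "'w measure \<Rightarrow> ('w \<Rightarrow> bool) \<Rightarrow> real \<Rightarrow> bool" where
  "bernoulli_rv M X p \<longleftrightarrow>
     X \<in> measurable M (count_space UNIV) \<and>
     distr M (count_space UNIV) X = measure_pmf (bernoulli_pmf p)"

text \<open>The argument \<open>B t p\<close> plays the role of the variable written $B_{it}(p)$, for a fixed
  product $i$; the period \<open>t\<close> ranges over a finite type with $T$ elements.\<close>

definition expected_sales ::
  "'w measure \<Rightarrow> ('n::finite \<Rightarrow> real \<Rightarrow> 'w \<Rightarrow> bool) \<Rightarrow> nat \<Rightarrow> real ^ 'n \<Rightarrow> real" where
  "expected_sales M B c u =
     (\<integral>\<omega>. min (real c) (\<Sum>t\<in>UNIV. of_bool (B t (u $ t) \<omega>)) \<partial>M)"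

text \<open>The derivative is taken within \<open>X\<close>, i.e. it is one-sided at boundary points, since the
  function is only considered on \<open>X\<close>. It is uniquely determined when \<open>X\<close> is a box with nonempty
  interior.\<close>

definition gradient_within :: "(real ^ 'n::finite \<Rightarrow> real) \<Rightarrow> (real ^ 'n) set \<Rightarrow> real ^ 'n \<Rightarrow> real ^ 'n" where
  "gradient_within G X x = (\<chi> i. frechet_derivative G (at x within X) (axis i 1))"

text \<open>In \<open>real ^ 'n\<close>, \<open>is_interval X\<close> says that \<open>X\<close> is a product of (possibly unbounded) intervals,
  and the order is component-wise. Degenerate boxes are excluded because gradients within them are
  not unique.\<close>

definition continuous_DR_submodular :: "(real ^ 'n::finite) set \<Rightarrow> (real ^ 'n \<Rightarrow> real) \<Rightarrow> bool" where
  "continuous_DR_submodular X G \<longleftrightarrow>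
     is_interval X \<and> interior X \<noteq> {} \<and> (\<forall>x\<in>X. 0 \<le> x) \<and>
     (\<forall>x\<in>X. 0 \<le> G x) \<and>
     G differentiable_on X \<and>
     (\<forall>x\<in>X. \<forall>y\<in>X. y \<le> x \<longrightarrow> gradient_within G X x \<le> gradient_within G X y)"

end

theory Submission
  imports Defs
begin

text \<open>Summing over the set of successful trials shows that the expected sales agree on the cube with
  a polynomial that is affine in each coordinate. Conditioning on the \<open>i\<close>-th trial, its \<open>i\<close>-th partial
  derivative is the expectation of \<open>h (k + 1) - h k\<close>, where \<open>h k = min c k\<close> and \<open>k\<close> counts the successes
  among the other trials. As \<open>h\<close> is concave, these increments are decreasing in \<open>k\<close>, and the expectation
  of a decreasing function of the number of successes decreases with the success probabilities.\<close>

text \<open>For \<open>u\<close> in the cube this is the expectation of \<open>h\<close> at the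
  number of successes among independent trials indexed by \<open>A\<close>. As a polynomial it makes
  sense for every real \<open>u\<close>, so it has two-sided derivatives even on the boundary of the
  cube.\<close>

definition bernoulli_mean :: "'a set \<Rightarrow> (nat \<Rightarrow> real) \<Rightarrow> ('a \<Rightarrow> real) \<Rightarrow> real" where
  "bernoulli_mean A h u = (\<Sum>S\<in>Pow A. h (card S) * ((\<Prod>t\<in>S. u t) * (\<Prod>t\<in>A - S. 1 - u t)))"

lemma bernoulli_mean_empty [simp]: "bernoulli_mean {} h u = h 0"
  by (simp add: bernoulli_mean_def)

lemma bernoulli_mean_cong:
  "(\<And>t. t \<in> A \<Longrightarrow> u t = v t) \<Longrightarrow> bernoulli_mean A h u = bernoulli_mean A h v"
  unfolding bernoulli_mean_def
  by (intro sum.cong arg_cong2[where f = "(*)"] prod.cong refl) auto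

lemma bernoulli_mean_diff:
  "bernoulli_mean A (\<lambda>k. g k - h k) u = bernoulli_mean A g u - bernoulli_mean A h u"
  by (simp add: bernoulli_mean_def left_diff_distrib sum_subtractf)

text \<open>Conditioning on trial \<open>i\<close>: a subset of \<open>insert i A\<close> either
  omits \<open>i\<close>, or comes from a unique subset of \<open>A\<close> by adding
  \<open>i\<close>, which shifts the argument of \<open>h\<close> by one.\<close>

lemma bernoulli_mean_insert:
  assumes "finite A" "i \<notin> A"
  shows "bernoulli_mean (insert i A) h u =
    (1 - u i) * bernoulli_mean A h u + u i * bernoulli_mean A (\<lambda>k. h (Suc k)) u"
proof -
  let ?w = "\<lambda>A S. (\<Prod>t\<in>S. u t) * (\<Prod>t\<in>A - S. 1 - u t)"
  have inj: "inj_on (insert i) (Pow A)"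
    using assms(2) by (auto simp: inj_on_def)
  have disj: "Pow A \<inter> insert i ` Pow A = {}"
    using assms(2) by auto
  have without: "h (card S) * ?w (insert i A) S = (1 - u i) * (h (card S) * ?w A S)"
    if "S \<in> Pow A" for S
  proof -
    have "insert i A - S = insert i (A - S)"
      using assms(2) that by auto
    then show ?thesis
      using assms by simp
  qed
  have with_i: "h (card (insert i S)) * ?w (insert i A) (insert i S) = u i * (h (Suc (card S)) * ?w A S)"
    if "S \<in> Pow A" for S
  proof -
    have "insert i A - insert i S = A - S" "i \<notin> S" "finite S"
      using assms that by (auto intro: finite_subset)
    then show ?thesis
      by simp
  qed
  have "bernoulli_mean (insert i A) h u = (\<Sum>S\<in>Pow A. h (card S) * ?w (insert i A) S)
      + (\<Sum>S\<in>Pow A. h (card (insert i S)) * ?w (insert i A) (insert i S))"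
    unfolding bernoulli_mean_def Pow_insert using assms(1) disj
    by (subst sum.union_disjoint) (simp_all only: sum.reindex[OF inj] o_def finite_Pow_iff finite_imageI)
  also have "\<dots> = (\<Sum>S\<in>Pow A. (1 - u i) * (h (card S) * ?w A S))
      + (\<Sum>S\<in>Pow A. u i * (h (Suc (card S)) * ?w A S))"
    by (intro arg_cong2[where f = "(+)"] sum.cong refl without with_i)
  finally show ?thesis
    by (simp only: bernoulli_mean_def sum_distrib_left)
qed

text \<open>Makes the affine dependence on \<open>u i\<close> explicit: the two means on the right
  involve only the other trials, and the second one is the slope.\<close>

lemma bernoulli_mean_remove:
  assumes "finite A" "i \<in> A"
  shows "bernoulli_mean A h u =
    bernoulli_mean (A - {i}) h u + u i * bernoulli_mean (A - {i}) (\<lambda>k. h (Suc k) - h k) u"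
  using bernoulli_mean_insert[of "A - {i}" i h u] assms
  by (simp add: insert_absorb bernoulli_mean_diff algebra_simps)

lemma bernoulli_mean_mono:
  assumes "\<And>t. t \<in> A \<Longrightarrow> u t \<in> {0..1}" "\<And>k. g k \<le> h k"
  shows "bernoulli_mean A g u \<le> bernoulli_mean A h u"
  unfolding bernoulli_mean_def
  by (intro sum_mono mult_right_mono mult_nonneg_nonneg prod_nonneg ballI) (use assms in \<open>auto simp: subset_iff\<close>)

text \<open>Condition on one trial and lower the probabilities in two stages, first those of the
  other trials and then that of trial \<open>i\<close>. The induction needs arbitrary
  \<open>h\<close>, because conditioning on a success replaces \<open>h\<close> by its
  shift.\<close>

lemma bernoulli_mean_antimono:
  assumes "finite A" "\<And>t. t \<in> A \<Longrightarrow> 0 \<le> v t" "\<And>t. t \<in> A \<Longrightarrow> v t \<le> u t" "\<And>t. t \<in> A \<Longrightarrow> u t \<le> 1"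
    and "antimono h"
  shows "bernoulli_mean A h u \<le> bernoulli_mean A h v"
  using assms
proof (induction A arbitrary: h rule: finite_induct)
  case empty
  then show ?case by simp
next
  case (insert i A)
  let ?h = "\<lambda>k. h (Suc k)"
  have i: "0 \<le> v i" "v i \<le> u i" "u i \<le> 1"
    using insert.prems by auto
  have v: "v t \<in> {0..1}" if "t \<in> A" for t
    using insert.prems(1-3)[of t] that by auto
  have shift: "bernoulli_mean A ?h v \<le> bernoulli_mean A h v"
    using insert.prems(4) v by (intro bernoulli_mean_mono) (auto simp: antimono_def)
  have "antimono ?h"
    using insert.prems(4) by (simp add: antimono_def)
  then have "bernoulli_mean A h u \<le> bernoulli_mean A h v" "bernoulli_mean A ?h u \<le> bernoulli_mean A ?h v"
    using insert.IH insert.prems by simp_all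
  then have "(1 - u i) * bernoulli_mean A h u + u i * bernoulli_mean A ?h u
      \<le> (1 - u i) * bernoulli_mean A h v + u i * bernoulli_mean A ?h v"
    using i by (intro add_mono mult_left_mono) auto
  \<comment> \<open>The gain is \<open>u i - v i\<close> times the gap in \<open>shift\<close>:
    weight moves from the smaller mean to the larger one.\<close>
  also have "\<dots> \<le> (1 - v i) * bernoulli_mean A h v + v i * bernoulli_mean A ?h v"
    using mult_left_mono[OF shift, of "u i - v i"] i by (simp add: algebra_simps)
  finally show ?case
    using insert.hyps by (simp add: bernoulli_mean_insert)
qed

lemma bernoulli_mean_differentiable:
  fixes x :: "real ^ 'n"
  shows "(\<lambda>u. bernoulli_mean A h (($) u)) differentiable (at x)"
proof -
  have "finite A" by simp
  then show ?thesis
  proof (induction A arbitrary: h rule: finite_induct)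
    case empty
    then show ?case by simp
  next
    case (insert i A)
    have "(\<lambda>u :: real ^ 'n. u $ i) differentiable (at x)"
      by (rule bounded_linear_imp_differentiable[OF bounded_linear_vec_nth])
    then show ?case
      unfolding bernoulli_mean_insert[OF insert.hyps]
      by (intro derivative_intros insert.IH)
        (auto intro!: derivative_intros)
  qed
qed

text \<open>Along the line through \<open>x\<close> in direction \<open>axis i 1\<close> the
  polynomial is affine with slope \<open>?d\<close>, and uniqueness of derivatives on the real line
  identifies this slope.\<close>

lemma has_derivative_bernoulli_mean_axis:
  fixes x :: "real ^ 'n"
  assumes "((\<lambda>u. bernoulli_mean UNIV h (($) u)) has_derivative D) (at x)"
  shows "D (axis i 1) = bernoulli_mean (UNIV - {i}) (\<lambda>k. h (Suc k) - h k) (($) x)"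
    (is "_ = ?d")
proof -
  let ?l = "\<lambda>s. x + s *\<^sub>R axis i 1"
  have "(?l has_derivative (\<lambda>s. s *\<^sub>R axis i 1)) (at 0)"
    by (auto intro!: derivative_eq_intros)
  from has_derivative_compose[OF this, of "\<lambda>u. bernoulli_mean UNIV h (($) u)" D] assms
  have 1: "((\<lambda>s. bernoulli_mean UNIV h (($) (?l s))) has_derivative (\<lambda>s. D (s *\<^sub>R axis i 1))) (at 0)"
    by simp
  have "bernoulli_mean (UNIV - {i}) g (($) (?l s)) = bernoulli_mean (UNIV - {i}) g (($) x)" for g s
    by (rule bernoulli_mean_cong) (simp add: axis_def)
  then have eq: "bernoulli_mean UNIV h (($) (?l s)) =
      bernoulli_mean (UNIV - {i}) h (($) x) + (x $ i + s) * ?d" for s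
    by (subst bernoulli_mean_remove[of _ i]) (simp_all add: axis_def)
  have "((\<lambda>s. bernoulli_mean UNIV h (($) (?l s))) has_derivative (\<lambda>s. s * ?d)) (at 0)"
    unfolding eq by (auto intro!: derivative_eq_intros)
  from fun_cong[OF has_derivative_unique[OF 1 this], of 1] show ?thesis
    by simp
qed

text \<open>Transfers differentiability and partial derivatives from the polynomial to any function
  that agrees with it on the cube, whatever its values elsewhere.\<close>

lemma gradient_within_bernoulli_mean:
  fixes x :: "real ^ 'n"
  assumes "x \<in> {0..1}" "\<And>u. u \<in> {0..1} \<Longrightarrow> G u = bernoulli_mean UNIV h (($) u)"
  shows "G differentiable (at x within {0..1})"
    and "gradient_within G {0..1} x $ i =
      bernoulli_mean (UNIV - {i}) (\<lambda>k. h (Suc k) - h k) (($) x)"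
proof -
  obtain D where D: "((\<lambda>u. bernoulli_mean UNIV h (($) u)) has_derivative D) (at x)"
    using bernoulli_mean_differentiable unfolding differentiable_def by blast
  then have G: "(G has_derivative D) (at x within {0..1})"
    using assms by (auto intro: has_derivative_transform has_derivative_at_withinI)
  then show "G differentiable (at x within {0..1})"
    unfolding differentiable_def by blast
  \<comment> \<open>The cube has positive width in every coordinate direction, so the derivative
    within it is unique at boundary points too.\<close>
  have "frechet_derivative G (at x within cbox 0 1) = D"
    using assms(1) G
    by (intro frechet_derivative_within_cbox) (auto simp: cbox_interval Basis_vec_def inner_axis)
  then show "gradient_within G {0..1} x $ i =
      bernoulli_mean (UNIV - {i}) (\<lambda>k. h (Suc k) - h k) (($) x)"
    using has_derivative_bernoulli_mean_axis[OF D]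
    by (simp add: gradient_within_def cbox_interval)
qed

lemma bernoulli_rv_prob:
  assumes "prob_space M" "bernoulli_rv M X p" "p \<in> {0..1}"
  shows "measure M (X -` {b} \<inter> space M) = (if b then p else 1 - p)"
proof -
  have "measure M (X -` {b} \<inter> space M) = measure (distr M (count_space UNIV) X) {b}"
    using assms(2) by (subst measure_distr) (auto simp: bernoulli_rv_def)
  also have "\<dots> = pmf (bernoulli_pmf p) b"
    using assms(2) by (simp add: bernoulli_rv_def pmf.rep_eq)
  finally show ?thesis
    using assms(3) by (cases b) auto
qed

lemma (in prob_space) expectation_card_indep_bernoulli:
  fixes X :: "'i::finite \<Rightarrow> 'a \<Rightarrow> bool"
  assumes "indep_vars (\<lambda>_. count_space UNIV) X UNIV"
    and "\<And>t. bernoulli_rv M (X t) (u t)" "\<And>t. u t \<in> {0..1}"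
  shows "expectation (\<lambda>\<omega>. h (card {t. X t \<omega>})) = bernoulli_mean UNIV h u"
proof -
  \<comment> \<open>The event that \<open>S\<close> is exactly the set of successful trials;
    \<open>{t \<in> S}\<close> is the singleton of a truth value.\<close>
  let ?E = "\<lambda>S. \<Inter>t\<in>UNIV. X t -` {t \<in> S} \<inter> space M"
  have E: "?E S \<in> sets M" for S
    using assms(2)
    by (intro sets.finite_INT measurable_sets[where A = "count_space UNIV"]) (auto simp: bernoulli_rv_def)
  have prob_E: "prob (?E S) = (\<Prod>t\<in>S. u t) * (\<Prod>t\<in>UNIV - S. 1 - u t)" for S
  proof -
    have "prob (?E S) = (\<Prod>t\<in>UNIV. prob (X t -` {t \<in> S} \<inter> space M))"
      using assms(1) by (intro indep_varsD_finite) auto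
    also have "\<dots> = (\<Prod>t\<in>UNIV. if t \<in> S then u t else 1 - u t)"
      by (intro prod.cong refl bernoulli_rv_prob[OF prob_space_axioms] assms)
    also have "\<dots> = (\<Prod>t\<in>S. u t) * (\<Prod>t\<in>UNIV - S. 1 - u t)"
      by (simp add: prod.If_cases Compl_eq_Diff_UNIV)
    finally show ?thesis .
  qed
  \<comment> \<open>Exactly one of these events contains \<open>\<omega>\<close>, so a single
    summand survives.\<close>
  have "h (card {t. X t \<omega>}) = (\<Sum>S\<in>Pow UNIV. h (card S) * indicator (?E S) \<omega>)" if "\<omega> \<in> space M" for \<omega>
  proof -
    have "\<omega> \<in> ?E S \<longleftrightarrow> S = {t. X t \<omega>}" for S
      using that by auto
    then have "(indicator (?E S) \<omega> :: real) = of_bool (S = {t. X t \<omega>})" for S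
      by (simp add: indicator_def)
    then show ?thesis
      by simp
  qed
  then have "expectation (\<lambda>\<omega>. h (card {t. X t \<omega>})) =
      expectation (\<lambda>\<omega>. \<Sum>S\<in>Pow UNIV. h (card S) * indicator (?E S) \<omega>)"
    by (intro Bochner_Integration.integral_cong) auto
  also have "\<dots> = (\<Sum>S\<in>Pow UNIV. h (card S) * prob (?E S))"
    using E by (subst Bochner_Integration.integral_sum) (auto simp: less_top[symmetric])
  also have "\<dots> = bernoulli_mean UNIV h u"
    by (simp only: prob_E bernoulli_mean_def)
  finally show ?thesis .
qed

theorem lemma4p3:
  fixes M :: "'w measure"
    and B :: "'n::finite \<Rightarrow> real \<Rightarrow> 'w \<Rightarrow> bool"
    and c :: nat
  assumes "prob_space M"
    and "\<And>t p. p \<in> {0..1} \<Longrightarrow> bernoulli_rv M (B t p) p"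
    and "\<And>u :: real ^ 'n. u \<in> {0..1} \<Longrightarrow>
           prob_space.indep_vars M (\<lambda>_. count_space UNIV) (\<lambda>t. B t (u $ t)) UNIV"
  shows "expected_sales M B c differentiable_on {0..1}
    \<and> continuous_DR_submodular {0..1} (expected_sales M B c)
    \<and> (\<forall>t. \<forall>u\<in>{0..1}. \<exists>a b. \<forall>x\<in>{0..1}.
          expected_sales M B c (\<chi> s. if s = t then x else u $ s) = a + b * x)"
proof -
  let ?F = "expected_sales M B c"
  define h where "h = (\<lambda>k. min (real c) (real k))"
  have F: "?F u = bernoulli_mean UNIV h (($) u)" if "u \<in> {0..1}" for u :: "real ^ 'n"
  proof -
    have u: "u $ t \<in> {0..1}" for t
      using that by (simp add: less_eq_vec_def)
    have "?F u = (\<integral>\<omega>. h (card {t. B t (u $ t) \<omega>}) \<partial>M)"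
      by (simp add: expected_sales_def h_def sum_of_bool_eq)
    also have "\<dots> = bernoulli_mean UNIV h (($) u)"
      using assms(2) u
      by (intro prob_space.expectation_card_indep_bernoulli[OF assms(1) assms(3)[OF that]]) auto
    finally show ?thesis .
  qed
  have diff: "?F differentiable_on {0..1}"
    unfolding differentiable_on_def using gradient_within_bernoulli_mean(1) F by blast
  \<comment> \<open>The increment is 1 for \<open>k < c\<close> and 0 from \<open>c\<close>
    on.\<close>
  have anti: "antimono (\<lambda>k. h (Suc k) - h k)"
    by (auto simp: antimono_def h_def)
  have grad: "gradient_within ?F {0..1} x \<le> gradient_within ?F {0..1} y"
    if "x \<in> {0..1}" "y \<in> {0..1}" "y \<le> x" for x y
  proof -
    have "gradient_within ?F {0..1} x $ i \<le> gradient_within ?F {0..1} y $ i" for i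
      using that anti
      by (simp only: gradient_within_bernoulli_mean(2)[OF _ F])
        (intro bernoulli_mean_antimono; simp add: less_eq_vec_def)
    then show ?thesis
      by (simp add: less_eq_vec_def)
  qed
  have "is_interval ({0..1} :: (real ^ 'n) set)" "interior ({0..1} :: (real ^ 'n) set) \<noteq> {}"
    by (auto simp flip: cbox_interval simp: is_interval_cbox box_ne_empty Basis_vec_def inner_axis)
  moreover have "0 \<le> ?F u" for u
    by (simp add: expected_sales_def sum_nonneg)
  ultimately have "continuous_DR_submodular {0..1} ?F"
    using diff grad by (auto simp: continuous_DR_submodular_def)
  moreover have "\<exists>a b. \<forall>x\<in>{0..1}. ?F (\<chi> s. if s = t then x else u $ s) = a + b * x"
    if "u \<in> {0..1}" for t u
  proof (intro exI ballI)
    fix x :: real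
    assume x: "x \<in> {0..1}"
    let ?v = "\<chi> s. if s = t then x else u $ s"
    have "?F ?v = bernoulli_mean UNIV h (($) ?v)"
      using that x by (intro F) (auto simp: less_eq_vec_def)
    also have "\<dots> = bernoulli_mean (UNIV - {t}) h (($) ?v)
        + x * bernoulli_mean (UNIV - {t}) (\<lambda>k. h (Suc k) - h k) (($) ?v)"
      by (subst bernoulli_mean_remove[of _ t]) simp_all
    \<comment> \<open>Away from \<open>t\<close> the vectors \<open>?v\<close> and \<open>u\<close>
      agree, so both coefficients are independent of \<open>x\<close> and can serve as the witnesses
      for \<open>a\<close> and \<open>b\<close>.\<close>
    also have "bernoulli_mean (UNIV - {t}) h (($) ?v) = bernoulli_mean (UNIV - {t}) h (($) u)"
      by (rule bernoulli_mean_cong) simp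
    also have "bernoulli_mean (UNIV - {t}) (\<lambda>k. h (Suc k) - h k) (($) ?v) =
        bernoulli_mean (UNIV - {t}) (\<lambda>k. h (Suc k) - h k) (($) u)"
      by (rule bernoulli_mean_cong) simp
    finally show "?F ?v = bernoulli_mean (UNIV - {t}) h (($) u)
        + bernoulli_mean (UNIV - {t}) (\<lambda>k. h (Suc k) - h k) (($) u) * x"
      by (simp add: mult.commute)
  qed
  ultimately show ?thesis
    using diff by blast
qed

end
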